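(* The following lower bounds hold: $$r_4(5,6) \ge 67,\quad r_4(6,6)\ge 133,\quad r_4(6,7)\ge 661,\quad r_4(6,13)\ge 50689,\quad r_4(7,7)\ge 3961,\quad r_4(8,8)\ge 194041.$$
   Context: For integers $k,p,q$, the Ramsey number $r_k(p,q)$ is the smallest integer $N$ such that for every coloring of all $k$-element subsets of $\{1,\dots,N\}$ with the colors red and blue, there exist either $p$ elements of $\{1,\dots,N\}$ all of whose $k$-element subsets are red, or $q$ elements of $\{1,\dots,N\}$ all of whose $k$-element subsets are blue. *)

theory Defs
  imports Complex_Main "HOL-Library.Ramsey"
begin

text \<open>
  Colour \<open>0\<close> plays the role of red and colour \<open>1\<close> that of blue: \<^term>\<open>partn_lst {1..N} [p, q] k\<close>
  says that every colouring of the \<open>k\<close>-subsets of \<open>{1..N}\<close> with these two colours admits a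
  \<open>p\<close>-set all of whose \<open>k\<close>-subsets have colour \<open>0\<close> or a \<open>q\<close>-set all of whose \<open>k\<close>-subsets have
  colour \<open>1\<close>.
\<close>

definition ramsey_number :: "nat \<Rightarrow> nat \<Rightarrow> nat \<Rightarrow> nat" where
  "ramsey_number k p q = (LEAST N. partn_lst {1..N} [p, q] k)"

text \<open>By Ramsey's theorem the minimum is over a nonempty set, so it is attained.\<close>

lemma partn_lst_ramsey_number: "partn_lst {1..ramsey_number k p q} [p, q] k"
  unfolding ramsey_number_def
proof (rule LeastI)
  let ?n = "ES k p q"
  show "partn_lst {1..?n} [p, q] k"
    unfolding partn_lst_def
  proof
    fix f :: "nat set \<Rightarrow> nat"
    assume f: "f \<in> nsets {1..?n} k \<rightarrow> {..<length [p, q]}"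
    have "Suc \<in> {..<?n} \<rightarrow> {1..?n}" by auto
    then have "f \<circ> (\<lambda>X. Suc ` X) \<in> nsets {..<?n} k \<rightarrow> {..<length [p, q]}"
      using f by (intro nsets_compose_image_funcset) auto
    then obtain i H where i: "i < length [p, q]" and H: "H \<in> nsets {..<?n} ([p, q] ! i)"
      and mono: "(f \<circ> (\<lambda>X. Suc ` X)) ` nsets H k \<subseteq> {i}"
      using partn_lstE [OF ramsey2_full] by blast
    have "Suc ` H \<in> nsets {1..?n} ([p, q] ! i)"
      using H by (auto simp: nsets_def card_image)
    moreover have "f ` nsets (Suc ` H) k \<subseteq> {i}"
    proof
      fix c assume "c \<in> f ` nsets (Suc ` H) k"
      then obtain X where "X \<in> nsets (Suc ` H) k" "c = f X" by blast
      then obtain Y where "Y \<in> nsets H k" "c = f (Suc ` Y)"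
        using nset_image_obtains [of X Suc H k] by auto
      then show "c \<in> {i}" using mono by auto
    qed
    ultimately show "\<exists>i<length [p, q]. monochromatic {1..?n} ([p, q] ! i) k f i"
      using i unfolding monochromatic_def by blast
  qed
qed

end

theory Submission
  imports Defs "HOL-Library.Z2"
begin

text \<open>
  Everything grows from one colouring of the 4-subsets of a 33-element set without monochromatic
  5-sets (\<open>avoidable_5_5_33\<close>), enlarged by a product construction (\<open>avoidable_product\<close>).

  The 33 points are the projective line \<open>F \<union> {\<infinity>}\<close> over the field \<open>F\<close> with 32 elements, and the
  colouring is invariant under the 992 affine maps \<open>x \<mapsto> m x + t\<close>.  They act sharply 2-transitively
  on \<open>F\<close>, so the colouring is given by the colours of the sets \<open>{0, 1, x, y}\<close> and \<open>{\<infinity>, 0, 1, x}\<close>,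
  and only the 5-sets \<open>{0, 1, x, y, z}\<close> and \<open>{\<infinity>, 0, 1, x, y}\<close> have to be examined.  Their
  4-subsets are brought into the first form by the maps \<open>u \<mapsto> u / x\<close> and \<open>u \<mapsto> (1 + u) / (1 + x)\<close>.
  On discrete logarithms these are a subtraction modulo 31 and a look-up of Zech logarithms, so
  the verification is rewriting with small numbers (\<open>quad_red_not_constant_all\<close>,
  \<open>triple_red_not_constant_all\<close>).

  For the product, let \<open>A\<close> be coloured without red \<open>p\<close>-clique and blue \<open>s\<close>-clique, and \<open>B\<close> without
  red \<open>(p - 1)\<close>-clique and blue \<open>q\<close>-clique, where \<open>2 s \<le> q + 1\<close>.  A 4-subset of \<open>A \<times> B\<close> is split by
  its first coordinates: it is coloured by \<open>B\<close> if it lies in one fibre, by \<open>A\<close> if it meets four,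
  red if it splits as \<open>3+1\<close>, and blue otherwise.  Then a red clique has at most one point
  outside any fibre that contains two of its points, and a blue clique that is not in one fibre
  has at most two points in each; hence there is no red \<open>p\<close>-clique and no blue \<open>q\<close>-clique.  With
  two points for \<open>A\<close>, or \<open>p - 1\<close> points and only red 4-sets, this yields factors 2 and \<open>p - 1\<close>, which
  lead to all the bounds except the one for \<open>(6, 13)\<close>; there \<open>A\<close> has 6 points and only blue 4-sets.
\<close>

section \<open>Colourings without monochromatic cliques\<close>

text \<open>
  The colouring of the \<open>k\<close>-subsets of \<open>V\<close> in which \<open>red\<close> holds of the red ones has no
  \<open>p\<close>-set with all \<open>k\<close>-subsets red and no \<open>q\<close>-set with all \<open>k\<close>-subsets blue.  Such sets are
  called red and blue cliques below.  The values of \<open>red\<close> outside the \<open>k\<close>-subsets of \<open>V\<close>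
  are irrelevant.
\<close>

definition avoiding :: "nat \<Rightarrow> nat \<Rightarrow> nat \<Rightarrow> 'a set \<Rightarrow> ('a set \<Rightarrow> bool) \<Rightarrow> bool" where
  "avoiding k p q V red \<longleftrightarrow>
     (\<forall>H\<in>[V]\<^bsup>p\<^esup>. \<exists>X\<in>[H]\<^bsup>k\<^esup>. \<not> red X) \<and> (\<forall>H\<in>[V]\<^bsup>q\<^esup>. \<exists>X\<in>[H]\<^bsup>k\<^esup>. red X)"

text \<open>
  Such a colouring exists on \<open>N\<close> vertices.  The vertex set \<open>{..<N}\<close> is only a representative:
  \<open>avoidableI\<close> below accepts a colouring of any set of that size.
\<close>

definition avoidable :: "nat \<Rightarrow> nat \<Rightarrow> nat \<Rightarrow> nat \<Rightarrow> bool" where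
  "avoidable k p q N \<longleftrightarrow> (\<exists>red. avoiding k p q {..<N} red)"

lemma nsets_image:
  assumes "inj_on g V" "X \<in> [V]\<^bsup>k\<^esup>"
  shows "g ` X \<in> [g ` V]\<^bsup>k\<^esup>"
  using assms by (auto simp: nsets_def card_image inj_on_subset)

lemma nsets_subset: "\<lbrakk>X \<in> [H]\<^bsup>k\<^esup>; H \<subseteq> V\<rbrakk> \<Longrightarrow> X \<in> [V]\<^bsup>k\<^esup>"
  using nsets_mono by blast

lemma avoiding_pullback:
  assumes av: "avoiding k p q V red" and inj: "inj_on g W" and sub: "g ` W \<subseteq> V"
  shows "avoiding k p q W (\<lambda>X. red (g ` X))"
proof -
  have *: "\<exists>X\<in>[H]\<^bsup>k\<^esup>. P (g ` X)"
    if H: "H \<in> [W]\<^bsup>m\<^esup>" and P: "\<forall>H\<in>[V]\<^bsup>m\<^esup>. \<exists>X\<in>[H]\<^bsup>k\<^esup>. P X" for H m P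
  proof -
    have "g ` H \<in> [V]\<^bsup>m\<^esup>"
      using nsets_subset [OF nsets_image [OF inj H] sub] .
    then obtain X where X: "X \<in> [g ` H]\<^bsup>k\<^esup>" "P X"
      using P by blast
    have "inj_on g H"
      using inj H by (auto simp: nsets_def intro: inj_on_subset)
    then show ?thesis
      using nset_image_obtains [OF X(1)] X(2) by metis
  qed
  show ?thesis
    using av *[of _ p "\<lambda>X. \<not> red X"] *[of _ q red] unfolding avoiding_def by blast
qed

lemma avoidableI:
  assumes "avoiding k p q V red" "finite V" "card V = N"
  shows "avoidable k p q N"
proof -
  obtain g where "bij_betw g {..<N} V"
    using assms by (metis ex_bij_betw_nat_finite atLeast0LessThan)
  then have "avoiding k p q {..<N} (\<lambda>X. red (g ` X))"
    by (intro avoiding_pullback [OF assms(1)]) (auto simp: bij_betw_def)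
  then show ?thesis
    by (auto simp: avoidable_def)
qed

lemma avoidable_swap:
  assumes "avoidable k p q N"
  shows "avoidable k q p N"
proof -
  obtain red where "avoiding k p q {..<N} red"
    using assms by (auto simp: avoidable_def)
  then have "avoiding k q p {..<N} (\<lambda>X. \<not> red X)"
    by (simp add: avoiding_def)
  then show ?thesis
    by (auto simp: avoidable_def)
qed

lemma avoidable_imp_less_ramsey_number:
  assumes "avoidable k p q N"
  shows "N < ramsey_number k p q"
proof (rule ccontr)
  let ?M = "ramsey_number k p q"
  assume "\<not> N < ?M"
  obtain red where red: "avoiding k p q {..<N} red"
    using assms by (auto simp: avoidable_def)
  have "inj_on (\<lambda>i. i - 1) {1..?M}" "(\<lambda>i. i - 1) ` {1..?M} \<subseteq> {..<N}"
    using \<open>\<not> N < ?M\<close> by (auto intro!: inj_onI)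
  then have av: "avoiding k p q {1..?M} (\<lambda>X. red ((\<lambda>i. i - 1) ` X))"
    by (rule avoiding_pullback [OF red])
  define f :: "nat set \<Rightarrow> nat" where "f X = (if red ((\<lambda>i. i - 1) ` X) then 0 else 1)" for X
  have "f \<in> [{1..?M}]\<^bsup>k\<^esup> \<rightarrow> {..<2}"
    by (auto simp: f_def)
  then obtain i H where i: "i < 2" and H: "H \<in> [{1..?M}]\<^bsup>([p, q] ! i)\<^esup>"
    and mono: "f ` [H]\<^bsup>k\<^esup> \<subseteq> {i}"
    by (rule partn_lstE [OF partn_lst_ramsey_number [of k p q]]) (auto simp: numeral_2_eq_2)
  show False
  proof (cases "i = 0")
    case True
    then obtain X where "X \<in> [H]\<^bsup>k\<^esup>" "f X = 1"
      using H av by (auto simp: avoiding_def f_def)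
    then show False
      using mono True by auto
  next
    case False
    then have "i = 1" using i by simp
    then obtain X where "X \<in> [H]\<^bsup>k\<^esup>" "f X = 0"
      using H av by (auto simp: avoiding_def f_def)
    then show False
      using mono \<open>i = 1\<close> by auto
  qed
qed

lemma obtain_nset:
  assumes "n \<le> card H"
  obtains S where "S \<in> [H]\<^bsup>n\<^esup>"
proof -
  obtain S where "S \<subseteq> H" "card S = n" "finite S"
    by (rule obtain_subset_with_card_n [OF assms])
  then show thesis
    by (intro that) (simp add: nsets_def)
qed

lemma avoidable_all_red:
  assumes "k \<le> s" "M < p"
  shows "avoidable k p s M"
proof -
  have "[H]\<^bsup>k\<^esup> \<noteq> {}" if "H \<in> [{..<M}]\<^bsup>s\<^esup>" for H
    using that assms(1) by (auto simp: nsets_eq_empty_iff) (auto simp: nsets_def)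
  then have "avoiding k p s {..<M} (\<lambda>_. True)"
    using assms(2) by (auto simp: avoiding_def nsets_eq_empty)
  then show ?thesis
    by (auto simp: avoidable_def)
qed

lemma avoidable_too_small:
  assumes "M < p" "M < s"
  shows "avoidable k p s M"
  using assms unfolding avoidable_def avoiding_def by (simp add: nsets_eq_empty)

section \<open>The product of two colourings\<close>

text \<open>
  The product of a colouring of \<open>A\<close> and a colouring of \<open>B\<close>.  A 4-subset of \<open>A \<times> B\<close> is divided
  into fibres by its first coordinates.  A set in a single fibre takes its colour from \<open>B\<close>,
  a transversal of four fibres takes its colour from \<open>A\<close>, the division \<open>3+1\<close> is red, and
  \<open>2+2\<close> and \<open>2+1+1\<close> are blue.
\<close>

definition product_red :: "('a set \<Rightarrow> bool) \<Rightarrow> ('b set \<Rightarrow> bool) \<Rightarrow> ('a \<times> 'b) set \<Rightarrow> bool" where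
  "product_red redA redB X \<longleftrightarrow>
     (card (fst ` X) = 1 \<and> redB (snd ` X)) \<or>
     (card (fst ` X) = 2 \<and> (\<exists>a. card {x\<in>X. fst x = a} = 3)) \<or>
     (card (fst ` X) = 4 \<and> redA (fst ` X))"

lemma inj_snd_fibre: "inj_on snd {x\<in>H. fst x = a}"
  by (rule inj_onI) (simp add: prod_eq_iff)

lemma lift_from_fibre:
  assumes H: "H \<in> [A \<times> B]\<^bsup>m\<^esup>" and m: "m' \<le> card {x\<in>H. fst x = a}"
    and P: "\<forall>S\<in>[B]\<^bsup>m'\<^esup>. \<exists>Y\<in>[S]\<^bsup>4\<^esup>. P Y"
  obtains X where "X \<in> [H]\<^bsup>4\<^esup>" "P (snd ` X)" "fst ` X = {a}"
proof -
  obtain S where S: "S \<in> [{x\<in>H. fst x = a}]\<^bsup>m'\<^esup>"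
    using obtain_nset [OF m] .
  have inj: "inj_on snd S"
    using S by (auto simp: nsets_def intro: inj_on_subset [OF inj_snd_fibre])
  have "snd ` S \<in> [B]\<^bsup>m'\<^esup>"
    using S H inj by (fastforce simp: nsets_def card_image)
  then obtain Y where Y: "Y \<in> [snd ` S]\<^bsup>4\<^esup>" "P Y"
    using P by blast
  then obtain X where X: "X \<in> [S]\<^bsup>4\<^esup>" "Y = snd ` X"
    using nset_image_obtains [OF Y(1) inj] by blast
  have "X \<noteq> {}"
    using X by (auto simp: nsets_def)
  then have "fst ` X = {a}"
    using X S by (auto simp: nsets_def)
  moreover have "X \<in> [H]\<^bsup>4\<^esup>"
    using X S by (auto simp: nsets_def)
  ultimately show thesis
    using that Y X by blast
qed

lemma lift_from_projection:
  assumes H: "H \<in> [A \<times> B]\<^bsup>m\<^esup>" and m: "m' \<le> card (fst ` H)"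
    and P: "\<forall>S\<in>[A]\<^bsup>m'\<^esup>. \<exists>Y\<in>[S]\<^bsup>4\<^esup>. P Y"
  obtains X where "X \<in> [H]\<^bsup>4\<^esup>" "P (fst ` X)" "card (fst ` X) = 4"
proof -
  obtain S where S: "S \<in> [fst ` H]\<^bsup>m'\<^esup>"
    using obtain_nset [OF m] .
  then have "S \<in> [A]\<^bsup>m'\<^esup>"
    using H by (fastforce simp: nsets_def)
  then obtain Y where Y: "Y \<in> [S]\<^bsup>4\<^esup>" "P Y"
    using P by blast
  then have "Y \<subseteq> fst ` H"
    using S by (auto simp: nsets_def)
  then obtain X where X: "X \<subseteq> H" "inj_on fst X" "fst ` X = Y"
    unfolding subset_image_inj by blast
  have "card Y = 4" "finite Y"
    using Y by (auto simp: nsets_def)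
  then have "X \<in> [H]\<^bsup>4\<^esup>"
    using X by (auto simp: nsets_def finite_image_iff card_image)
  then show thesis
    using that Y X \<open>card Y = 4\<close> by blast
qed

text \<open>
  A red clique with two points in one fibre has at most one point outside it, because two
  outside points would give a blue division \<open>2+2\<close> or \<open>2+1+1\<close>.  So a red \<open>p\<close>-clique has at least
  \<open>p - 1\<close> points in one fibre, or all its points lie in different
  fibres and their first coordinates form a red clique of \<open>A\<close>.
\<close>

lemma product_has_blue:
  assumes A: "\<forall>S\<in>[A]\<^bsup>p\<^esup>. \<exists>Y\<in>[S]\<^bsup>4\<^esup>. \<not> redA Y"
    and B: "\<forall>S\<in>[B]\<^bsup>(p-1)\<^esup>. \<exists>Y\<in>[S]\<^bsup>4\<^esup>. \<not> redB Y"
    and H: "H \<in> [A \<times> B]\<^bsup>p\<^esup>"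
  shows "\<exists>X\<in>[H]\<^bsup>4\<^esup>. \<not> product_red redA redB X"
proof -
  have fin: "finite H" and card: "card H = p"
    using H by (auto simp: nsets_def)
  consider a where "p - 1 \<le> card {x\<in>H. fst x = a}"
    | a where "2 \<le> card {x\<in>H. fst x = a}" "card {x\<in>H. fst x = a} < p - 1"
    | "\<And>a. card {x\<in>H. fst x = a} < 2"
    by (meson not_le)
  then show ?thesis
  proof cases
    case 1
    then obtain X where "X \<in> [H]\<^bsup>4\<^esup>" "\<not> redB (snd ` X)" "fst ` X = {a}"
      using lift_from_fibre [OF H _ B] by metis
    then show ?thesis
      by (intro bexI [of _ X]) (auto simp: product_red_def)
  next
    case 2
    let ?F = "{x\<in>H. fst x = a}"
    have "2 \<le> card (H - ?F)"
      using 2 fin card by (subst card_Diff_subset) auto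
    from obtain_nset [OF this] obtain U where U: "U \<subseteq> H - ?F" "card U = 2"
      by (auto simp: nsets_def)
    from obtain_nset [OF 2(1)] obtain T where T: "T \<subseteq> ?F" "card T = 2"
      by (auto simp: nsets_def)
    obtain u v where uv: "U = {u, v}" "u \<noteq> v"
      using U by (auto simp: card_2_iff)
    obtain x y where xy: "T = {x, y}" "x \<noteq> y"
      using T by (auto simp: card_2_iff)
    have fibre: "fst x = a" "fst y = a" "fst u \<noteq> a" "fst v \<noteq> a" and inH: "{x, y, u, v} \<subseteq> H"
      using U T uv xy by auto
    have dist: "distinct [x, y, u, v]"
      using fibre uv xy by auto
    have "\<not> product_red redA redB {x, y, u, v}"
    proof (cases "fst u = fst v")
      case True
      have no3: "card {z \<in> {x, y, u, v}. fst z = b} \<noteq> 3" for b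
      proof -
        have "{z \<in> {x, y, u, v}. fst z = b} \<subseteq> (if b = a then T else U)"
          using fibre True uv(1) xy(1) by auto
        moreover have "card (if b = a then T else U) = 2" "finite (if b = a then T else U)"
          using T(2) U(2) uv xy by auto
        ultimately have "card {z \<in> {x, y, u, v}. fst z = b} \<le> 2"
          by (metis card_mono)
        then show ?thesis
          by linarith
      qed
      have "fst ` {x, y, u, v} = {a, fst u}"
        using fibre True by auto
      then have two: "card (fst ` {x, y, u, v}) = 2"
        using fibre by simp
      show ?thesis
        unfolding product_red_def two using no3 by simp
    next
      case False
      then have "card (fst ` {x, y, u, v}) = 3"
        using fibre by (auto simp: card_insert_if)
      then show ?thesis
        by (simp add: product_red_def)
    qed
    moreover have "{x, y, u, v} \<in> [H]\<^bsup>4\<^esup>"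
      using inH dist by (simp add: nsets_def)
    ultimately show ?thesis
      by blast
  next
    case 3
    have "inj_on fst H"
    proof (rule inj_onI, rule ccontr)
      fix x y assume xy: "x \<in> H" "y \<in> H" "fst x = fst y" "x \<noteq> y"
      then have "card {x, y} \<le> card {z\<in>H. fst z = fst x}"
        using fin by (intro card_mono) auto
      then show False
        using 3 [of "fst x"] xy by simp
    qed
    then have "p \<le> card (fst ` H)"
      using card by (simp add: card_image)
    then obtain X where "X \<in> [H]\<^bsup>4\<^esup>" "\<not> redA (fst ` X)" "card (fst ` X) = 4"
      using lift_from_projection [OF H _ A] by metis
    then show ?thesis
      by (intro bexI [of _ X]) (auto simp: product_red_def)
  qed
qed

text \<open>
  A blue clique that meets two fibres has at most two points in each of them, because three
  points of a fibre and one outside point form a red set.  It therefore meets at least half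
  as many fibres as it has points, and its first coordinates form a blue clique of \<open>A\<close>.
\<close>

lemma product_has_red:
  assumes A: "\<forall>S\<in>[A]\<^bsup>s\<^esup>. \<exists>Y\<in>[S]\<^bsup>4\<^esup>. redA Y"
    and B: "\<forall>S\<in>[B]\<^bsup>q\<^esup>. \<exists>Y\<in>[S]\<^bsup>4\<^esup>. redB Y"
    and H: "H \<in> [A \<times> B]\<^bsup>q\<^esup>" and q: "2 * s \<le> q + 1"
  shows "\<exists>X\<in>[H]\<^bsup>4\<^esup>. product_red redA redB X"
proof -
  have fin: "finite H" and card: "card H = q"
    using H by (auto simp: nsets_def)
  consider a where "q \<le> card {x\<in>H. fst x = a}"
    | a where "3 \<le> card {x\<in>H. fst x = a}" "card {x\<in>H. fst x = a} < q"
    | "\<And>a. card {x\<in>H. fst x = a} < 3"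
    by (meson not_le)
  then show ?thesis
  proof cases
    case 1
    then obtain X where "X \<in> [H]\<^bsup>4\<^esup>" "redB (snd ` X)" "fst ` X = {a}"
      using lift_from_fibre [OF H _ B] by metis
    then show ?thesis
      by (intro bexI [of _ X]) (auto simp: product_red_def)
  next
    case 2
    let ?F = "{x\<in>H. fst x = a}"
    have "?F \<noteq> H"
      using 2 card by auto
    then obtain u where u: "u \<in> H" "fst u \<noteq> a"
      by blast
    from obtain_nset [OF 2(1)] obtain T where T: "T \<subseteq> ?F" "card T = 3"
      by (auto simp: nsets_def)
    have finT: "finite T" and "u \<notin> T" "T \<noteq> {}"
      using T u by (auto intro: card_ge_0_finite)
    then have "insert u T \<in> [H]\<^bsup>4\<^esup>"
      using T u by (auto simp: nsets_def)
    moreover have "fst ` insert u T = {fst u, a}"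
      using T \<open>T \<noteq> {}\<close> by auto
    then have "card (fst ` insert u T) = 2"
      using u by simp
    moreover have "{x \<in> insert u T. fst x = a} = T"
      using T u by auto
    then have "card {x \<in> insert u T. fst x = a} = 3"
      using T by simp
    ultimately show ?thesis
      unfolding product_red_def by blast
  next
    case 3
    have "(\<Union>a\<in>fst ` H. {x\<in>H. fst x = a}) = H"
      by auto
    then have "card H \<le> (\<Sum>a\<in>fst ` H. card {x\<in>H. fst x = a})"
      using card_UN_le [of "fst ` H" "\<lambda>a. {x\<in>H. fst x = a}"] fin by simp
    also have "\<dots> \<le> (\<Sum>a\<in>fst ` H. 2)"
      using 3 by (intro sum_mono) (simp add: less_Suc_eq_le numeral_3_eq_3 numeral_2_eq_2)
    finally have "s \<le> card (fst ` H)"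
      using card q by simp
    then obtain X where "X \<in> [H]\<^bsup>4\<^esup>" "redA (fst ` X)" "card (fst ` X) = 4"
      using lift_from_projection [OF H _ A] by metis
    then show ?thesis
      by (intro bexI [of _ X]) (auto simp: product_red_def)
  qed
qed

lemma avoidable_product:
  assumes "avoidable 4 p s M" "avoidable 4 (p - 1) q N" "2 * s \<le> q + 1"
  shows "avoidable 4 p q (M * N)"
proof -
  obtain redA redB where "avoiding 4 p s {..<M} redA" "avoiding 4 (p - 1) q {..<N} redB"
    using assms by (auto simp: avoidable_def)
  then have "avoiding 4 p q ({..<M} \<times> {..<N}) (product_red redA redB)"
    using product_has_blue [of "{..<M}" p redA "{..<N}" redB]
      product_has_red [of "{..<M}" s redA "{..<N}" q redB] assms(3)
    unfolding avoiding_def by simp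
  then show ?thesis
    by (rule avoidableI) auto
qed

text \<open>
  The two extreme choices of the first factor: two vertices, where there are no 4-sets at all,
  and \<open>p\<close> vertices with all 4-sets red.
\<close>

lemma avoidable_double:
  assumes "avoidable 4 p q N" "5 \<le> q" "2 \<le> p"
  shows "avoidable 4 (Suc p) q (2 * N)"
  using avoidable_product [of "Suc p" 3 2 q N] assms by (simp add: avoidable_too_small)

lemma avoidable_times:
  assumes "avoidable 4 p q N" "7 \<le> q"
  shows "avoidable 4 (Suc p) q (p * N)"
  using avoidable_product [of "Suc p" 4 p q N] assms by (simp add: avoidable_all_red)

section \<open>The field with 32 elements\<close>

text \<open>
  The field with 32 elements as \<open>\<int>\<^sub>2[x] / (x\<^sup>5 + x\<^sup>2 + 1)\<close>: the element \<open>GF a0 a1 a2 a3 a4\<close>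
  stands for \<open>a0 + a1 x + a2 x\<^sup>2 + a3 x\<^sup>3 + a4 x\<^sup>4\<close>.
\<close>

datatype gf32 = GF bit bit bit bit bit

instantiation gf32 :: comm_ring_1
begin
definition zero_gf32 where "0 = GF 0 0 0 0 0"
definition one_gf32 where "1 = GF 1 0 0 0 0"
fun plus_gf32 where "GF a0 a1 a2 a3 a4 + GF b0 b1 b2 b3 b4 = GF (a0+b0) (a1+b1) (a2+b2) (a3+b3) (a4+b4)"
definition uminus_gf32 where "- (x::gf32) = x"
definition minus_gf32 where "(x::gf32) - y = x + y"
fun times_gf32 where "GF a0 a1 a2 a3 a4 * GF b0 b1 b2 b3 b4 =
  (let c0 = a0*b0; c1 = a0*b1+a1*b0; c2 = a0*b2+a1*b1+a2*b0; c3 = a0*b3+a1*b2+a2*b1+a3*b0;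
       c4 = a0*b4+a1*b3+a2*b2+a3*b1+a4*b0; c5 = a1*b4+a2*b3+a3*b2+a4*b1; c6 = a2*b4+a3*b3+a4*b2;
       c7 = a3*b4+a4*b3; c8 = a4*b4
   in GF (c0+c5+c8) (c1+c6) (c2+c5+c7+c8) (c3+c6+c8) (c4+c7))"
instance
proof
  fix x y z :: gf32
  \<comment> \<open>Otherwise sums and products of bits become logical operations, on which the ring laws do not act.\<close>
  note [simp del] = add_bit_eq_xor mult_bit_eq_and
  show "x * y * z = x * (y * z)"
    by (cases x; cases y; cases z) (simp add: Let_def algebra_simps)
  show "x * y = y * x"
    by (cases x; cases y) (simp add: Let_def algebra_simps)
  show "1 * x = x"
    by (cases x) (simp add: one_gf32_def)
  show "(x + y) * z = x * z + y * z"
    by (cases x; cases y; cases z) (simp add: Let_def algebra_simps)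
  show "x + y + z = x + (y + z)"
    by (cases x; cases y; cases z) (simp add: algebra_simps)
  show "x + y = y + x"
    by (cases x; cases y) (simp add: algebra_simps)
  show "0 + x = x"
    by (cases x) (simp add: zero_gf32_def)
  show "- x + x = 0"
    by (cases x) (simp add: zero_gf32_def uminus_gf32_def)
  show "x - y = x + - y"
    by (simp add: minus_gf32_def uminus_gf32_def)
  show "(0::gf32) \<noteq> 1"
    by (simp add: zero_gf32_def one_gf32_def)
qed
end


lemma minus_eq_plus_gf32: "x - y = x + (y :: gf32)"
  by (simp add: minus_gf32_def)

text \<open>
  The class of \<open>x\<close>, a generator of the cyclic multiplicative group of order 31.
\<close>

definition \<alpha> :: gf32 where "\<alpha> = GF 0 1 0 0 0"

lemma alpha_times: "\<alpha> * GF a b c d e = GF e a (b + e) c d"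
  by (simp add: \<alpha>_def)

lemma alpha_31: "\<alpha> ^ 31 = 1"
  by (simp add: numeral_eq_Suc one_gf32_def alpha_times)

lemma nonzero_alpha_power:
  assumes "x \<noteq> 0"
  obtains i where "i < 31" "x = \<alpha> ^ i"
proof -
  obtain a b c d e where x: "x = GF a b c d e"
    by (cases x)
  have "\<exists>i\<in>set [0..<31]. x = \<alpha> ^ i"
    using assms unfolding x
    by (cases a; cases b; cases c; cases d; cases e)
      (simp_all add: upt_rec zero_gf32_def one_gf32_def alpha_times)
  then show thesis
    using that by auto
qed

lemma distinct_alpha_powers: "distinct (map (\<lambda>i. \<alpha> ^ i) [0..<31])"
  by (simp add: upt_rec one_gf32_def alpha_times)

lemma alpha_power_inject: "\<alpha> ^ i = \<alpha> ^ j \<Longrightarrow> i < 31 \<Longrightarrow> j < 31 \<Longrightarrow> i = j"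
  using distinct_alpha_powers by (auto simp: distinct_map dest: inj_onD)

instantiation gf32 :: field
begin
definition inverse_gf32 where "inverse (x::gf32) = x ^ 30"
definition divide_gf32 where "(x::gf32) div y = x * inverse y"
instance
proof
  fix x y :: gf32
  show "inverse x * x = 1" if nz: "x \<noteq> 0"
  proof -
    obtain i where x: "x = \<alpha> ^ i"
      using nonzero_alpha_power [OF nz] by blast
    have "inverse x * x = x ^ 31"
      using power_add [of x 30 1] by (simp add: inverse_gf32_def)
    also have "\<dots> = (\<alpha> ^ 31) ^ i"
      by (simp add: x mult.commute flip: power_mult)
    finally show ?thesis
      by (simp add: alpha_31)
  qed
  show "x div y = x * inverse y"
    by (simp add: divide_gf32_def)
  show "inverse 0 = (0::gf32)"
    by (simp add: inverse_gf32_def)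
qed
end

lemma card_gf32: "card (UNIV :: gf32 set) = 32" and finite_gf32: "finite (UNIV :: gf32 set)"
proof -
  define S where "S = set (map (\<lambda>i. \<alpha> ^ i) [0..<31])"
  have eq: "UNIV = insert 0 S"
    by (auto simp: S_def image_iff) (metis atLeastLessThan_iff nonzero_alpha_power zero_le)
  have "card S = 31"
    using distinct_alpha_powers unfolding S_def by (simp only: distinct_card) simp
  moreover have "\<alpha> \<noteq> 0"
    by (simp add: \<alpha>_def zero_gf32_def)
  then have "0 \<notin> S"
    by (auto simp: S_def)
  moreover have "finite S"
    by (simp add: S_def)
  ultimately show "card (UNIV :: gf32 set) = 32" and "finite (UNIV :: gf32 set)"
    by (simp_all add: eq)
qed

text \<open>
  The discrete logarithm to base \<open>\<alpha>\<close>; its value at \<open>0\<close> is not used.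
\<close>

definition dlog :: "gf32 \<Rightarrow> nat" where
  "dlog x = (LEAST i. \<alpha> ^ i = x)"

lemma dlog_alpha_power: "i < 31 \<Longrightarrow> dlog (\<alpha> ^ i) = i"
proof -
  assume i: "i < 31"
  show ?thesis
    unfolding dlog_def
  proof (rule Least_equality)
    fix j assume "\<alpha> ^ j = \<alpha> ^ i"
    then show "i \<le> j"
      using alpha_power_inject [of j i] i by linarith
  qed simp
qed

lemma alpha_dlog: "x \<noteq> 0 \<Longrightarrow> \<alpha> ^ dlog x = x" and dlog_less: "x \<noteq> 0 \<Longrightarrow> dlog x < 31"
  by (metis dlog_alpha_power nonzero_alpha_power)+

lemma alpha_power_mod: "\<alpha> ^ (i mod 31) = \<alpha> ^ i"
proof -
  have "\<alpha> ^ i = (\<alpha> ^ 31) ^ (i div 31) * \<alpha> ^ (i mod 31)"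
    by (simp flip: power_mult power_add)
  then show ?thesis
    by (simp add: alpha_31)
qed

text \<open>
  Subtraction modulo 31, for \<open>i \<le> 31\<close>.  The summand 31 keeps the difference of natural numbers from
  being truncated.
\<close>

definition sub31 :: "nat \<Rightarrow> nat \<Rightarrow> nat" where
  "sub31 j i = (31 + j - i) mod 31"

lemma dlog_divide:
  assumes "x \<noteq> 0" "y \<noteq> 0"
  shows "dlog (y / x) = sub31 (dlog y) (dlog x)"
proof -
  have "\<alpha> ^ (31 + dlog y - dlog x) * x = \<alpha> ^ (31 + dlog y - dlog x) * \<alpha> ^ dlog x"
    using assms by (simp add: alpha_dlog)
  also have "\<dots> = \<alpha> ^ 31 * \<alpha> ^ dlog y"
    using dlog_less [OF assms(1)] by (simp flip: power_add)
  also have "\<dots> = y"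
    using assms by (simp add: alpha_31 alpha_dlog)
  finally have "y / x = \<alpha> ^ sub31 (dlog y) (dlog x)"
    using assms by (simp add: sub31_def alpha_power_mod nonzero_divide_eq_eq)
  then show ?thesis
    by (simp add: dlog_alpha_power sub31_def)
qed

lemma dlog_1: "dlog 1 = 0"
  using dlog_alpha_power [of 0] by simp

lemma dlog_pos: "x \<noteq> 0 \<Longrightarrow> x \<noteq> 1 \<Longrightarrow> 1 \<le> dlog x"
  by (metis alpha_dlog less_one not_le power_0)

text \<open>
  The table of Zech logarithms \<open>zech 1, \<dots>, zech 30\<close>, defined by
  \<open>\<alpha> ^ zech i = 1 + \<alpha> ^ i\<close>.  With it, both \<open>x \<mapsto> 1 + x\<close> and division are computed on logarithms.
\<close>

definition zech_list :: "nat list" where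
  "zech_list = [
    18, 5, 29, 10, 2, 27, 22, 20, 16, 4, 19, 23, 14, 13, 24, 9, 30, 1, 11, 8, 25, 7, 12,
    15, 21, 28, 6, 26, 3, 17]"

definition zech :: "nat \<Rightarrow> nat" where
  "zech i = zech_list ! (i - 1)"

lemma zech_all: "list_all (\<lambda>i. \<alpha> ^ zech i = \<alpha> ^ i + 1 \<and> zech i < 31) [1..<31]"
  by (simp add: upt_rec zech_def zech_list_def) (simp add: numeral_eq_Suc one_gf32_def \<alpha>_def)

lemma dlog_add_1:
  assumes "x \<noteq> 0" "x \<noteq> 1"
  shows "dlog (1 + x) = zech (dlog x)"
proof -
  have "dlog x \<in> set [1..<31]"
    using assms dlog_pos dlog_less by auto
  then have "\<alpha> ^ zech (dlog x) = \<alpha> ^ dlog x + 1" "zech (dlog x) < 31"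
    using zech_all unfolding list_all_iff by blast+
  then show ?thesis
    using assms by (metis add.commute alpha_dlog dlog_alpha_power)
qed

section \<open>A colouring of the projective line with 33 points\<close>

text \<open>
  The coordinate of \<open>c\<close> with respect to \<open>(a, b)\<close>: its image under the affine map that takes \<open>a\<close> to
  \<open>0\<close> and \<open>b\<close> to \<open>1\<close>.
\<close>

definition ratio :: "gf32 \<Rightarrow> gf32 \<Rightarrow> gf32 \<Rightarrow> gf32" where
  "ratio a b c = (c - a) / (b - a)"

lemma ratio_neq_0: "distinct [a, b, c] \<Longrightarrow> ratio a b c \<noteq> 0"
  and ratio_neq_1: "distinct [a, b, c] \<Longrightarrow> ratio a b c \<noteq> 1"
  by (auto simp: ratio_def)

lemma ratio_inject: "a \<noteq> b \<Longrightarrow> ratio a b c = ratio a b d \<longleftrightarrow> c = d"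
  by (auto simp: ratio_def)

lemma ratio_swap: "a \<noteq> b \<Longrightarrow> ratio b a c = 1 + ratio a b c"
proof -
  assume "a \<noteq> b"
  then have "ratio b a c = 1 - ratio a b c"
    by (simp add: ratio_def field_simps)
  then show ?thesis
    by (simp add: minus_eq_plus_gf32)
qed

lemma ratio_change: "distinct [a, b, c] \<Longrightarrow> ratio a c d = ratio a b d / ratio a b c"
  by (auto simp: ratio_def)

lemma ratio_self: "a \<noteq> b \<Longrightarrow> ratio a b b = 1"
  by (simp add: ratio_def)

text \<open>
  The logarithm of the coordinate of \<open>c\<close>; it lies between 1 and 30 when the points are distinct.
\<close>

definition log_ratio :: "gf32 \<Rightarrow> gf32 \<Rightarrow> gf32 \<Rightarrow> nat" where
  "log_ratio a b c = dlog (ratio a b c)"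

lemma log_ratio_range: "distinct [a, b, c] \<Longrightarrow> log_ratio a b c \<in> set [1..<31]"
  using dlog_pos dlog_less ratio_neq_0 ratio_neq_1 by (simp add: log_ratio_def)

lemma log_ratio_inject:
  assumes "distinct [a, b, c]" "distinct [a, b, d]"
  shows "log_ratio a b c = log_ratio a b d \<longleftrightarrow> c = d"
  using alpha_dlog [OF ratio_neq_0 [OF assms(1)]] alpha_dlog [OF ratio_neq_0 [OF assms(2)]]
    ratio_inject [of a b c d] assms(1) unfolding log_ratio_def by auto

lemma log_ratio_swap: "distinct [a, b, c] \<Longrightarrow> log_ratio b a c = zech (log_ratio a b c)"
  unfolding log_ratio_def
  using dlog_add_1 [OF ratio_neq_0 ratio_neq_1] ratio_swap [of a b c] by simp

lemma log_ratio_change: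
  "distinct [a, b, c, d] \<Longrightarrow> log_ratio a c d = sub31 (log_ratio a b d) (log_ratio a b c)"
  unfolding log_ratio_def
  using ratio_change [of a b c d] ratio_neq_0 [of a b c] ratio_neq_0 [of a b d]
  by (simp add: dlog_divide)

lemma log_ratio_inverse:
  "distinct [a, b, c] \<Longrightarrow> log_ratio a c b = sub31 0 (log_ratio a b c)"
  unfolding log_ratio_def
  using ratio_change [of a b c b] dlog_divide [of "ratio a b c" 1] ratio_neq_0 [of a b c]
  by (simp add: ratio_self dlog_1)

text \<open>
  The coordinates of \<open>d\<close> with respect to the pairs \<open>(a, b)\<close> and \<open>(b, c)\<close> are related by
  \<open>x \<mapsto> (1 + x) / (1 + r)\<close>, where \<open>r\<close> is the coordinate of \<open>c\<close>.
\<close>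

lemma log_ratio_swap_change:
  assumes "distinct [a, b, c, d]"
  shows "log_ratio b c d = sub31 (zech (log_ratio a b d)) (zech (log_ratio a b c))"
  using log_ratio_change [of b a c d] log_ratio_swap [of a b c] log_ratio_swap [of a b d] assms
  by auto

text \<open>
  The colouring of the 4-sets \<open>{0, 1, \<alpha>\<^sup>i, \<alpha>\<^sup>j}\<close>: row \<open>i\<close> lists the exponents \<open>j\<close> for which the
  set is red, rows being numbered from 1 to 30.  The red sets make up 18 of the 40 orbits of the
  affine group on the 4-subsets of the field.  The choice was found by a search by computer among
  the colourings that are constant on the orbits.
\<close>

definition quad_rows :: "nat list list" where
  "quad_rows = [
    [3, 7, 11, 13, 17, 19, 20, 22, 25, 27, 28, 29],
    [3, 4, 5, 6, 7, 9, 10, 12, 16, 20, 24, 28, 29, 30],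
    [1, 2, 4, 5, 6, 7, 10, 13, 18, 20, 22, 26, 28, 29],
    [2, 3, 5, 9, 10, 12, 13, 16, 17, 21, 26, 28, 29],
    [2, 3, 4, 8, 9, 10, 15, 16, 17, 22, 23, 26, 27, 29],
    [2, 3, 7, 14, 15, 16, 17, 18, 20, 21, 23, 27, 30],
    [1, 2, 3, 6, 9, 15, 18, 19, 20, 22, 28, 29],
    [5, 13, 14, 16, 18, 19, 22, 23, 24, 25, 27, 29],
    [2, 4, 5, 7, 10, 12, 14, 16, 17, 20, 25, 27],
    [2, 3, 4, 5, 9, 14, 16, 23, 25, 26, 28, 29, 30],
    [1, 12, 13, 14, 17, 18, 20, 22, 23, 24, 25, 26],
    [2, 4, 9, 11, 13, 19, 20, 24, 25, 26, 27, 30],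
    [1, 3, 4, 8, 11, 12, 16, 19, 20, 21, 24, 27],
    [6, 8, 9, 10, 11, 15, 18, 19, 20, 23, 25, 29],
    [5, 6, 7, 14, 17, 19, 20, 21, 23, 24, 25, 28],
    [2, 4, 5, 6, 8, 9, 10, 13, 21, 22, 23, 30],
    [1, 4, 5, 6, 9, 11, 15, 23, 25, 26, 27, 28],
    [3, 6, 7, 8, 11, 14, 19, 21, 22, 26, 29, 30],
    [1, 7, 8, 12, 13, 14, 15, 18, 21, 23, 28, 30],
    [1, 2, 3, 6, 7, 9, 11, 12, 13, 14, 15, 21],
    [4, 6, 13, 15, 16, 18, 19, 20, 23, 24, 25, 26, 30],
    [1, 3, 5, 7, 8, 11, 16, 18, 24, 26, 27, 29],
    [5, 6, 8, 10, 11, 14, 15, 16, 17, 19, 21, 28],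
    [2, 8, 11, 12, 13, 15, 21, 22, 25, 26, 27, 30],
    [1, 8, 9, 10, 11, 12, 14, 15, 17, 21, 24, 27, 28],
    [3, 4, 5, 10, 11, 12, 17, 18, 21, 22, 24, 28, 29, 30],
    [1, 5, 6, 8, 9, 12, 13, 17, 22, 24, 25, 29, 30],
    [1, 2, 3, 4, 7, 10, 15, 17, 19, 23, 25, 26, 29, 30],
    [1, 2, 3, 4, 5, 7, 8, 10, 14, 18, 22, 26, 27, 28],
    [2, 6, 10, 12, 16, 18, 19, 21, 24, 26, 27, 28]]"

definition quad_red :: "nat \<Rightarrow> nat \<Rightarrow> bool" where
  "quad_red i j \<longleftrightarrow> j \<in> set (quad_rows ! (i - 1))"

text \<open>
  The exponents \<open>i\<close> for which \<open>{\<infinity>, 0, 1, \<alpha>\<^sup>i}\<close> is red.  These triples \<open>{0, 1, \<alpha>\<^sup>i}\<close> make up two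
  of the five orbits on triples.
\<close>

definition triple_red :: "nat \<Rightarrow> bool" where
  "triple_red i \<longleftrightarrow> i \<in> set [1, 8, 11, 12, 13, 14, 17, 18, 19, 20, 23, 30]"

text \<open>
  The finite checks are stated with \<open>list_all\<close> over explicit intervals, which the simplifier
  unrolls with the equations \<open>upt_simps\<close> (\<open>1\<close> also occurs as \<open>Suc 0\<close>).  The tables are first
  turned into one rewrite rule for each entry.
\<close>

lemma upt_from_1: "[1..<numeral n] = (if (1::nat) < numeral n then 1 # [2..<numeral n] else [])"
  by (simp add: upt_rec numeral_2_eq_2)

lemma Suc_Suc_0: "Suc (Suc 0) = 2"
  by simp

lemmas upt_simps = upt_from_1 upt_from_1 [simplified] upt_rec_numeral Suc_Suc_0

lemma quad_red_all:
  "list_all (\<lambda>i. list_all (\<lambda>j. quad_red i j \<longleftrightarrow> j \<in> set (quad_rows ! (i - 1))) [1..<31]) [1..<31]"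
  by (simp only: quad_red_def list_all_iff) simp

lemmas quad_red_simps = quad_red_all [unfolded quad_rows_def, simplified upt_simps, simplified]

lemma zech_values: "list_all (\<lambda>i. zech i = zech_list ! (i - 1)) [1..<31]"
  by (simp only: zech_def list_all_iff) simp

lemmas zech_simps = zech_values [unfolded zech_list_def, simplified upt_simps, simplified]

text \<open>
  With \<open>x = \<alpha>\<^sup>i\<close> and \<open>y = \<alpha>\<^sup>j\<close>, the three parts say that the colour of \<open>{0, 1, x, y}\<close> is unchanged
  when \<open>x\<close> and \<open>y\<close>, or \<open>0\<close> and \<open>1\<close>, or \<open>1\<close> and \<open>x\<close> are exchanged before the coordinates are
  computed.
\<close>

lemma quad_red_symmetries_all:
  "list_all (\<lambda>i. list_all (\<lambda>j. if i = j then True else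
     (quad_red j i \<longleftrightarrow> quad_red i j) \<and> (quad_red (zech i) (zech j) \<longleftrightarrow> quad_red i j) \<and>
     (quad_red (sub31 0 i) (sub31 j i) \<longleftrightarrow> quad_red i j)) [1..<31]) [1..<31]"
  by (simp add: quad_red_simps zech_simps sub31_def upt_simps)

lemma triple_red_symmetries_all:
  "list_all (\<lambda>i. (triple_red (zech i) \<longleftrightarrow> triple_red i) \<and> (triple_red (sub31 0 i) \<longleftrightarrow> triple_red i)) [1..<31]"
  by (simp add: triple_red_def zech_simps sub31_def upt_simps)

text \<open>
  With \<open>x = \<alpha>\<^sup>i\<close>, \<open>y = \<alpha>\<^sup>j\<close> and \<open>z = \<alpha>\<^sup>k\<close>, the five values compared are the colours of the
  five 4-subsets of \<open>{0, 1, x, y, z}\<close>; the last two are those without \<open>1\<close> and without \<open>0\<close>.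
  Nested conditionals spare the simplifier most of the look-ups.
\<close>

lemma quad_red_not_constant_all:
  "list_all (\<lambda>i. list_all (\<lambda>j. list_all (\<lambda>k.
     if quad_red i j = quad_red i k then
       if quad_red i j = quad_red j k then
         quad_red (sub31 j i) (sub31 k i) \<noteq> quad_red i j \<or>
         quad_red (sub31 (zech j) (zech i)) (sub31 (zech k) (zech i)) \<noteq> quad_red i j
       else True
     else True) [Suc j..<31]) [Suc i..<31]) [1..<31]"
  by (simp add: quad_red_simps zech_simps sub31_def upt_simps)

text \<open>
  The same for the five 4-subsets of \<open>{\<infinity>, 0, 1, x, y}\<close>.
\<close>

lemma triple_red_not_constant_all:
  "list_all (\<lambda>i. list_all (\<lambda>j. if i = j then True else
     if triple_red i = quad_red i j then
       if triple_red j = quad_red i j then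
         triple_red (sub31 j i) \<noteq> quad_red i j \<or>
         triple_red (sub31 (zech j) (zech i)) \<noteq> quad_red i j
       else True
     else True) [1..<31]) [1..<31]"
  by (simp add: triple_red_def quad_red_simps zech_simps sub31_def upt_simps)

text \<open>
  Whether a 4-set of field elements, or a triple of field elements together with \<open>\<infinity>\<close>, is red,
  computed from an enumeration of the elements.  Invariance under affine maps holds by
  construction.  That the enumeration does not matter is proved below.
\<close>

definition quad_colour :: "gf32 \<Rightarrow> gf32 \<Rightarrow> gf32 \<Rightarrow> gf32 \<Rightarrow> bool" where
  "quad_colour a b c d = quad_red (log_ratio a b c) (log_ratio a b d)"

definition triple_colour :: "gf32 \<Rightarrow> gf32 \<Rightarrow> gf32 \<Rightarrow> bool" where
  "triple_colour a b c = triple_red (log_ratio a b c)"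

lemma quad_red_symmetries:
  assumes "i \<in> set [1..<31]" "j \<in> set [1..<31]" "i \<noteq> j"
  shows "quad_red j i \<longleftrightarrow> quad_red i j" "quad_red (zech i) (zech j) \<longleftrightarrow> quad_red i j"
    "quad_red (sub31 0 i) (sub31 j i) \<longleftrightarrow> quad_red i j"
proof -
  have "if i = j then True else (quad_red j i \<longleftrightarrow> quad_red i j) \<and>
     (quad_red (zech i) (zech j) \<longleftrightarrow> quad_red i j) \<and>
     (quad_red (sub31 0 i) (sub31 j i) \<longleftrightarrow> quad_red i j)"
    using quad_red_symmetries_all assms(1,2) unfolding list_all_iff by blast
  then show "quad_red j i \<longleftrightarrow> quad_red i j" "quad_red (zech i) (zech j) \<longleftrightarrow> quad_red i j"
    "quad_red (sub31 0 i) (sub31 j i) \<longleftrightarrow> quad_red i j"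
    using assms(3) by simp_all
qed

lemma triple_red_symmetries:
  assumes "i \<in> set [1..<31]"
  shows "triple_red (zech i) \<longleftrightarrow> triple_red i" "triple_red (sub31 0 i) \<longleftrightarrow> triple_red i"
  using bspec [OF triple_red_symmetries_all [unfolded list_all_iff] assms] by simp_all

lemma quad_colour_swaps:
  assumes "distinct [a, b, c, d]"
  shows "quad_colour b a c d = quad_colour a b c d"
    and "quad_colour a c b d = quad_colour a b c d"
    and "quad_colour a b d c = quad_colour a b c d"
proof -
  have d: "distinct [a, b, c]" "distinct [a, b, d]" "c \<noteq> d"
    using assms by auto
  have "log_ratio a b c \<in> set [1..<31]" "log_ratio a b d \<in> set [1..<31]" "log_ratio a b c \<noteq> log_ratio a b d"
    using log_ratio_range [OF d(1)] log_ratio_range [OF d(2)] log_ratio_inject [OF d(1,2)] d(3) by simp_all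
  note sym = quad_red_symmetries [OF this]
  show "quad_colour b a c d = quad_colour a b c d"
    using sym(2) by (simp only: quad_colour_def log_ratio_swap [OF d(1)] log_ratio_swap [OF d(2)])
  show "quad_colour a c b d = quad_colour a b c d"
    using sym(3) by (simp only: quad_colour_def log_ratio_inverse [OF d(1)] log_ratio_change [OF assms])
  show "quad_colour a b d c = quad_colour a b c d"
    using sym(1) by (simp only: quad_colour_def)
qed

lemma triple_colour_swaps:
  assumes "distinct [a, b, c]"
  shows "triple_colour b a c = triple_colour a b c"
    and "triple_colour a c b = triple_colour a b c"
  using triple_red_symmetries [OF log_ratio_range [OF assms]]
  by (simp_all only: triple_colour_def log_ratio_swap [OF assms] log_ratio_inverse [OF assms])

text \<open>
  A function that does not change under transpositions of neighbouring arguments depends only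
  on the set of its arguments, as long as these are distinct.
\<close>

lemma symmetric3:
  fixes P :: "'a \<Rightarrow> 'a \<Rightarrow> 'a \<Rightarrow> bool"
  assumes swap: "\<And>a b c. distinct [a, b, c] \<Longrightarrow> P b a c = P a b c"
    "\<And>a b c. distinct [a, b, c] \<Longrightarrow> P a c b = P a b c"
    and "distinct [a, b, c]" "distinct [a', b', c']" "{a, b, c} = {a', b', c'}"
  shows "P a b c = P a' b' c'"
proof -
  have "a' \<in> {a, b, c}" "b' \<in> {a, b, c}" "c' \<in> {a, b, c}"
    using assms(5) by auto
  then have "(a', b', c') \<in> {(a, b, c), (a, c, b), (b, a, c), (b, c, a), (c, a, b), (c, b, a)}"
    using assms(4) by auto
  then show ?thesis
    using swap(1) [of a b c] swap(2) [of a b c] swap(1) [of a c b] swap(2) [of b a c]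
      swap(2) [of c a b] assms(3) by auto
qed

lemma symmetric4:
  fixes P :: "'a \<Rightarrow> 'a \<Rightarrow> 'a \<Rightarrow> 'a \<Rightarrow> bool"
  assumes swap: "\<And>a b c d. distinct [a, b, c, d] \<Longrightarrow> P b a c d = P a b c d"
    "\<And>a b c d. distinct [a, b, c, d] \<Longrightarrow> P a c b d = P a b c d"
    "\<And>a b c d. distinct [a, b, c, d] \<Longrightarrow> P a b d c = P a b c d"
    and "distinct [a, b, c, d]" "distinct [a', b', c', d']" "{a, b, c, d} = {a', b', c', d'}"
  shows "P a b c d = P a' b' c' d'"
proof -
  have tail: "P x y z w = P x y' z' w'"
    if d: "distinct [x, y, z, w]" and d': "distinct [x, y', z', w']"
      and eq: "{y, z, w} = {y', z', w'}" for x y z w y' z' w'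
  proof -
    define Q where "Q y z w \<longleftrightarrow> x \<notin> {y, z, w} \<longrightarrow> P x y z w" for y z w
    have "Q y z w = Q y' z' w'"
    proof (rule symmetric3 [of Q])
      fix a b c :: 'a
      assume "distinct [a, b, c]"
      then show "Q b a c = Q a b c" "Q a c b = Q a b c"
        using swap(2) [of x a b c] swap(3) [of x a b c] by (auto simp: Q_def)
    qed (use d d' eq in simp_all)
    then show ?thesis
      using d d' by (simp add: Q_def)
  qed
  consider "a' = a" | "a' = b" | "a' = c" | "a' = d"
    using assms(6) by blast
  then show ?thesis
  proof cases
    case 1
    then have "{b, c, d} = {b', c', d'}"
      using assms(4-6) by auto
    then show ?thesis
      using tail [of a b c d b' c' d'] assms(4,5) 1 by simp
  next
    case 2
    then have "{a, c, d} = {b', c', d'}"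
      using assms(4-6) by auto
    then show ?thesis
      using tail [of b a c d b' c' d'] assms(4,5) 2 swap(1) [of a b c d] by simp
  next
    case 3
    then have "{a, b, d} = {b', c', d'}"
      using assms(4-6) by auto
    then show ?thesis
      using tail [of c a b d b' c' d'] assms(4,5) 3 swap(2) [of a b c d] swap(1) [of a c b d] by auto
  next
    case 4
    then have "{a, b, c} = {b', c', d'}"
      using assms(4-6) by auto
    then show ?thesis
      using tail [of d a b c b' c' d'] assms(4,5) 4
        swap(3) [of a b c d] swap(2) [of a b d c] swap(1) [of a d b c] by auto
  qed
qed

text \<open>
  The colouring of the 4-subsets of the projective line over the field, with \<open>None\<close> as the point
  \<open>\<infinity>\<close>.
\<close>

definition affine_red :: "gf32 option set \<Rightarrow> bool" where
  "affine_red X \<longleftrightarrow>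
     (if None \<in> X
      then \<exists>a b c. distinct [a, b, c] \<and> X = insert None (Some ` {a, b, c}) \<and> triple_colour a b c
      else \<exists>a b c d. distinct [a, b, c, d] \<and> X = Some ` {a, b, c, d} \<and> quad_colour a b c d)"

lemma affine_red_quad:
  assumes "distinct [a, b, c, d]"
  shows "affine_red (Some ` {a, b, c, d}) \<longleftrightarrow> quad_colour a b c d"
proof -
  have "quad_colour a b c d" if "distinct [a', b', c', d']" "quad_colour a' b' c' d'"
    "Some ` {a, b, c, d} = Some ` {a', b', c', d'}" for a' b' c' d'
  proof -
    have "{a', b', c', d'} = {a, b, c, d}"
      using that(3) by (simp only: inj_image_eq_iff [OF inj_Some])
    then show ?thesis
      using symmetric4 [of quad_colour a' b' c' d' a b c d] quad_colour_swaps that assms by simp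
  qed
  moreover have "None \<notin> Some ` {a, b, c, d}"
    by blast
  ultimately show ?thesis
    unfolding affine_red_def using assms by (simp only: if_False) blast
qed

lemma affine_red_triple:
  assumes "distinct [a, b, c]"
  shows "affine_red (insert None (Some ` {a, b, c})) \<longleftrightarrow> triple_colour a b c"
proof -
  have "triple_colour a b c" if "distinct [a', b', c']" "triple_colour a' b' c'"
    "insert None (Some ` {a, b, c}) = insert None (Some ` {a', b', c'})" for a' b' c'
  proof -
    have "Some ` {a, b, c} = Some ` {a', b', c'}"
      using that(3) by (subst (asm) insert_ident) auto
    then have "{a', b', c'} = {a, b, c}"
      by (simp only: inj_image_eq_iff [OF inj_Some])
    then show ?thesis
      using symmetric3 [of triple_colour a' b' c' a b c] triple_colour_swaps that assms by simp
  qed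
  moreover have "None \<in> insert None (Some ` {a, b, c})"
    by blast
  ultimately show ?thesis
    unfolding affine_red_def using assms by (simp only: if_True) blast
qed

lemma finite_points_not_constant:
  assumes "card T = 5"
  obtains a b c d e where "T = {a, b, c, d, e}" "distinct [a, b, c, d, e]"
    "\<not> (quad_colour a b c d = quad_colour a b c e \<and> quad_colour a b c d = quad_colour a b d e \<and>
        quad_colour a b c d = quad_colour a c d e \<and> quad_colour a b c d = quad_colour b c d e)"
proof -
  obtain a T' where a: "T = insert a T'" "a \<notin> T'" "card T' = 4"
    using assms card_Suc_eq [of T 4] by auto
  then obtain b U where b: "T' = insert b U" "b \<notin> U" "card U = 3"
    using card_Suc_eq [of T' 3] by auto
  have "finite U"
    using b by (simp add: card_ge_0_finite)
  note ab = a b this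
  \<comment> \<open>The finite check covers increasing exponents only, so the last three points are sorted
    by their logarithms.\<close>
  have inj: "inj_on (log_ratio a b) U"
  proof (rule inj_onI)
    fix x y assume "x \<in> U" "y \<in> U" "log_ratio a b x = log_ratio a b y"
    then show "x = y"
      using ab log_ratio_inject [of a b x y] by auto
  qed
  then have "log_ratio a b ` U \<in> [UNIV]\<^bsup>3\<^esup>"
    using ab by (simp add: nsets_def card_image)
  then obtain i j k where ijk: "log_ratio a b ` U = {i, j, k}" "i < j" "j < k"
    by (auto simp: ordered_nsets_3_eq)
  then obtain c d e where cde: "c \<in> U" "d \<in> U" "e \<in> U"
    and log: "i = log_ratio a b c" "j = log_ratio a b d" "k = log_ratio a b e"
    by (metis (no_types, opaque_lifting) imageE insertCI)
  have d: "distinct [a, b, c, d, e]"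
    using cde log ijk ab by auto
  have "U = {c, d, e}"
    using d cde ab by (intro card_seteq [symmetric]) auto
  then have T: "T = {a, b, c, d, e}"
    using ab by simp
  have "i \<in> set [1..<31]" "j \<in> set [1..<31]" "k \<in> set [1..<31]"
    unfolding log using d by (intro log_ratio_range; simp)+
  then have "i \<in> set [1..<31]" "j \<in> set [Suc i..<31]" "k \<in> set [Suc j..<31]"
    using ijk by simp_all
  then have "if quad_red i j = quad_red i k then
       if quad_red i j = quad_red j k then
         quad_red (sub31 j i) (sub31 k i) \<noteq> quad_red i j \<or>
         quad_red (sub31 (zech j) (zech i)) (sub31 (zech k) (zech i)) \<noteq> quad_red i j
       else True
     else True"
    using quad_red_not_constant_all unfolding list_all_iff by blast
  moreover have "quad_colour a b c d = quad_red i j" "quad_colour a b c e = quad_red i k"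
    "quad_colour a b d e = quad_red j k"
    by (simp_all add: quad_colour_def log)
  moreover have "quad_colour a c d e = quad_red (sub31 j i) (sub31 k i)"
    using d by (simp add: quad_colour_def log log_ratio_change [of a b c])
  moreover have "quad_colour b c d e = quad_red (sub31 (zech j) (zech i)) (sub31 (zech k) (zech i))"
    using d by (simp add: quad_colour_def log log_ratio_swap_change [of a b c])
  ultimately show thesis
    by (intro that [OF T d]) metis
qed

lemma infinite_point_not_constant:
  assumes "distinct [a, b, c, d]"
  shows "\<not> (triple_colour a b c = quad_colour a b c d \<and> triple_colour a b d = quad_colour a b c d \<and>
        triple_colour a c d = quad_colour a b c d \<and> triple_colour b c d = quad_colour a b c d)"
proof -
  define i j where ij: "i = log_ratio a b c" "j = log_ratio a b d"
  have "i \<in> set [1..<31]" "j \<in> set [1..<31]"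
    unfolding ij using assms by (intro log_ratio_range; simp)+
  moreover have "i \<noteq> j"
    unfolding ij using assms by (subst log_ratio_inject) auto
  ultimately have "if triple_red i = quad_red i j then
       if triple_red j = quad_red i j then
         triple_red (sub31 j i) \<noteq> quad_red i j \<or>
         triple_red (sub31 (zech j) (zech i)) \<noteq> quad_red i j
       else True
     else True"
    using bspec [OF bspec [OF triple_red_not_constant_all [unfolded list_all_iff]]]
    by (metis (full_types))
  moreover have "triple_colour a c d = triple_red (sub31 j i)"
    using assms by (simp add: triple_colour_def ij log_ratio_change [of a b c])
  moreover have "triple_colour b c d = triple_red (sub31 (zech j) (zech i))"
    using assms by (simp add: triple_colour_def ij log_ratio_swap_change [of a b c])
  moreover have "triple_colour a b c = triple_red i" "triple_colour a b d = triple_red j"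
    "quad_colour a b c d = quad_red i j"
    by (simp_all add: triple_colour_def quad_colour_def ij)
  ultimately show ?thesis
    by metis
qed

lemma affine_red_not_constant:
  assumes "card (H :: gf32 option set) = 5"
  shows "\<exists>X\<in>[H]\<^bsup>4\<^esup>. \<exists>Y\<in>[H]\<^bsup>4\<^esup>. affine_red X \<noteq> affine_red Y"
proof (cases "None \<in> H")
  case True
  define T where "T = {x. Some x \<in> H}"
  have H: "H = insert None (Some ` T)"
    using True by (auto simp: T_def image_iff) (metis option.exhaust)
  have "finite H"
    using assms by (simp add: card_ge_0_finite)
  then have "finite T"
    unfolding H by (simp add: finite_image_iff)
  then have "card T = 4"
    using assms H by (simp add: card_image)
  then obtain a b c d where T: "T = {a, b, c, d}" and d: "distinct [a, b, c, d]"
    by (auto simp: card_Suc_eq numeral_eq_Suc)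
  have in4: "Some ` {a, b, c, d} \<in> [H]\<^bsup>4\<^esup>" "insert None (Some ` {a, b, c}) \<in> [H]\<^bsup>4\<^esup>"
    "insert None (Some ` {a, b, d}) \<in> [H]\<^bsup>4\<^esup>" "insert None (Some ` {a, c, d}) \<in> [H]\<^bsup>4\<^esup>"
    "insert None (Some ` {b, c, d}) \<in> [H]\<^bsup>4\<^esup>"
    using d by (auto simp: H T nsets_def)
  have d3: "distinct [a, b, c]" "distinct [a, b, d]" "distinct [a, c, d]" "distinct [b, c, d]"
    using d by auto
  show ?thesis
    using infinite_point_not_constant [OF d] in4
    unfolding affine_red_quad [OF d, symmetric] d3 [THEN affine_red_triple, symmetric] by metis
next
  case False
  define T where "T = {x. Some x \<in> H}"
  have H: "H = Some ` T"
    using False by (auto simp: T_def image_iff) (metis option.exhaust)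
  then have "card T = 5"
    using assms by (simp add: card_image)
  then obtain a b c d e where T: "T = {a, b, c, d, e}" and d: "distinct [a, b, c, d, e]"
    and nc: "\<not> (quad_colour a b c d = quad_colour a b c e \<and> quad_colour a b c d = quad_colour a b d e \<and>
        quad_colour a b c d = quad_colour a c d e \<and> quad_colour a b c d = quad_colour b c d e)"
    by (rule finite_points_not_constant)
  have in4: "Some ` {a, b, c, d} \<in> [H]\<^bsup>4\<^esup>" "Some ` {a, b, c, e} \<in> [H]\<^bsup>4\<^esup>"
    "Some ` {a, b, d, e} \<in> [H]\<^bsup>4\<^esup>" "Some ` {a, c, d, e} \<in> [H]\<^bsup>4\<^esup>"
    "Some ` {b, c, d, e} \<in> [H]\<^bsup>4\<^esup>"
    using d by (auto simp: H T nsets_def)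
  have d4: "distinct [a, b, c, d]" "distinct [a, b, c, e]" "distinct [a, b, d, e]"
    "distinct [a, c, d, e]" "distinct [b, c, d, e]"
    using d by auto
  show ?thesis
    using nc in4 unfolding d4 [THEN affine_red_quad, symmetric] by metis
qed

lemma card_projective_line: "card (UNIV :: gf32 option set) = 33" "finite (UNIV :: gf32 option set)"
  by (simp_all add: UNIV_option_conv card_image card_gf32 finite_gf32)

lemma avoidable_5_5_33: "avoidable 4 5 5 33"
proof (rule avoidableI)
  show "avoiding 4 5 5 UNIV affine_red"
    unfolding avoiding_def
  proof (intro conjI ballI)
    fix H :: "gf32 option set"
    assume "H \<in> [UNIV]\<^bsup>5\<^esup>"
    then have "\<exists>X\<in>[H]\<^bsup>4\<^esup>. \<exists>Y\<in>[H]\<^bsup>4\<^esup>. affine_red X \<noteq> affine_red Y"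
      by (intro affine_red_not_constant) (simp add: nsets_def)
    then show "\<exists>X\<in>[H]\<^bsup>4\<^esup>. \<not> affine_red X" "\<exists>X\<in>[H]\<^bsup>4\<^esup>. affine_red X"
      by blast+
  qed
qed (fact card_projective_line)+

section \<open>The lower bounds\<close>

theorem mainTheorem7:
  shows "ramsey_number 4 5 6 \<ge> 67 \<and>
         ramsey_number 4 6 6 \<ge> 133 \<and>
         ramsey_number 4 6 7 \<ge> 661 \<and>
         ramsey_number 4 6 13 \<ge> 50689 \<and>
         ramsey_number 4 7 7 \<ge> 3961 \<and>
         ramsey_number 4 8 8 \<ge> 194041"
proof -
  have grow: "avoidable 4 (5 + n) 5 (33 * 2 ^ n)" for n
  proof (induction n)
    case 0
    show ?case
      using avoidable_5_5_33 by simp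
  next
    case (Suc n)
    have "avoidable 4 (Suc (5 + n)) 5 (2 * (33 * 2 ^ n))"
      by (rule avoidable_double [OF Suc]) simp_all
    also have "2 * (33 * 2 ^ n) = (33 * 2 ^ Suc n :: nat)"
      by simp
    finally show ?case
      by (simp only: add_Suc_right)
  qed
  have r65: "avoidable 4 6 5 66" and r75: "avoidable 4 7 5 132" and r13: "avoidable 4 13 5 8448"
    using grow [of 1] grow [of 2] grow [of 8] by simp_all
  note r56 = avoidable_swap [OF r65]
  have r66: "avoidable 4 6 6 132"
    using avoidable_double [OF r56] by simp
  have r67: "avoidable 4 6 7 660"
    using avoidable_times [OF avoidable_swap [OF r75]] by simp
  have r77: "avoidable 4 7 7 3960"
    using avoidable_times [OF r67] by simp
  have r87: "avoidable 4 8 7 27720"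
    using avoidable_times [OF r77] by simp
  have r88: "avoidable 4 8 8 194040"
    using avoidable_times [OF avoidable_swap [OF r87]] by simp
  \<comment> \<open>Six vertices with all 4-sets blue serve as the first factor of the product.\<close>
  have "avoidable 4 6 7 6"
    by (rule avoidable_swap, rule avoidable_all_red) simp_all
  then have r613: "avoidable 4 6 13 50688"
    using avoidable_product [of 6 7 6 13 8448] avoidable_swap [OF r13] by simp
  show ?thesis
    using avoidable_imp_less_ramsey_number [OF r56] avoidable_imp_less_ramsey_number [OF r66]
      avoidable_imp_less_ramsey_number [OF r67] avoidable_imp_less_ramsey_number [OF r613]
      avoidable_imp_less_ramsey_number [OF r77] avoidable_imp_less_ramsey_number [OF r88]
    by simp
qed

end
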